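(* Let $k$ be a field of characteristic zero, let $G$ be a group and let $V,W$ be linear representations of $G$ over $k$. The set $E=(V\otimes W)\times G$ with the product $$\Big(\sum_i v_i\otimes w_i,\,a\Big)\Big(\sum_j v'_j\otimes w'_j,\,b\Big)=\Big(\sum_i (b^{-1}a^{-1}ba)v_i\otimes w_i+\sum_j (b^{-1}a^{-2}b)v'_j\otimes a w'_j,\;ab\Big)$$ is a loop such that $G\cong \{0\otimes 0\}\times G\subseteq M(E)$.
   Context: A loop is a non-empty set with a binary product having a two-sided unit and such that all left and right multiplications $L_x:y\mapsto xy$ and $R_x:y\mapsto yx$ are bijective. A Moufang element of a loop $E$ is an element $a\in E$ with $a(x(ay))=((ax)a)y$ and $((xa)y)a=x(a(ya))$ for all $x,y\in E$. $M(E)$ denotes the set of all Moufang elements of $E$. Tensor products are over $k$. *)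

theory Defs
  imports "HOL-Algebra.Module" "HOL-Algebra.Group_Action" "HOL-Algebra.Generated_Groups"
    "HOL-Algebra.Free_Abelian_Groups"
begin

locale loop =
  fixes E (structure)
  assumes m_closed [intro, simp]: "\<lbrakk>x \<in> carrier E; y \<in> carrier E\<rbrakk> \<Longrightarrow> x \<otimes> y \<in> carrier E"
    and one_closed [intro, simp]: "\<one> \<in> carrier E"
    and l_one [simp]: "x \<in> carrier E \<Longrightarrow> \<one> \<otimes> x = x"
    and r_one [simp]: "x \<in> carrier E \<Longrightarrow> x \<otimes> \<one> = x"
    and bij_left_mult: "x \<in> carrier E \<Longrightarrow> bij_betw (\<lambda>y. x \<otimes> y) (carrier E) (carrier E)"
    and bij_right_mult: "x \<in> carrier E \<Longrightarrow> bij_betw (\<lambda>y. y \<otimes> x) (carrier E) (carrier E)"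

definition moufang_elements :: "('a, 'm) monoid_scheme \<Rightarrow> 'a set"
  where "moufang_elements E =
    {a \<in> carrier E. \<forall>x \<in> carrier E. \<forall>y \<in> carrier E.
       a \<otimes>\<^bsub>E\<^esub> (x \<otimes>\<^bsub>E\<^esub> (a \<otimes>\<^bsub>E\<^esub> y)) = ((a \<otimes>\<^bsub>E\<^esub> x) \<otimes>\<^bsub>E\<^esub> a) \<otimes>\<^bsub>E\<^esub> y \<and>
       ((x \<otimes>\<^bsub>E\<^esub> a) \<otimes>\<^bsub>E\<^esub> y) \<otimes>\<^bsub>E\<^esub> a = x \<otimes>\<^bsub>E\<^esub> (a \<otimes>\<^bsub>E\<^esub> (y \<otimes>\<^bsub>E\<^esub> a))}"

locale char_zero_field = field K for K (structure) +
  assumes char_zero: "[n] \<cdot> \<one> = \<zero> \<Longrightarrow> n = (0::nat)"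

text \<open>The maps \<open>\<rho> g\<close> are elements of \<open>BijGroup (carrier V)\<close>, hence permutations of the
  carrier of \<open>V\<close>; they have the conventional value \<open>undefined\<close> outside this carrier.\<close>

locale linear_representation =
  field K + module K V + group_action G "carrier V" \<rho> for K and G and V and \<rho> +
  assumes action_add: "\<lbrakk>g \<in> carrier G; u \<in> carrier V; v \<in> carrier V\<rbrakk>
      \<Longrightarrow> \<rho> g (u \<oplus>\<^bsub>V\<^esub> v) = \<rho> g u \<oplus>\<^bsub>V\<^esub> \<rho> g v"
    and action_smult: "\<lbrakk>g \<in> carrier G; c \<in> carrier K; v \<in> carrier V\<rbrakk>
      \<Longrightarrow> \<rho> g (c \<odot>\<^bsub>V\<^esub> v) = c \<odot>\<^bsub>V\<^esub> \<rho> g v"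

text \<open>The tensor product over \<open>K\<close> is the quotient of the free abelian group on
  \<open>carrier V \<times> carrier W\<close> by the subgroup generated by the usual relations. The scalar
  multiplication of the quotient comes from that of \<open>V\<close>.\<close>

definition tensor_relations ::
    "('k, 'm) ring_scheme \<Rightarrow> ('k, 'v, 'n) module_scheme \<Rightarrow> ('k, 'w, 'p) module_scheme
     \<Rightarrow> ('v \<times> 'w \<Rightarrow>\<^sub>0 int) set"
  where "tensor_relations K V W =
      {frag_of (v \<oplus>\<^bsub>V\<^esub> v', w) - frag_of (v, w) - frag_of (v', w) | v v' w.
         v \<in> carrier V \<and> v' \<in> carrier V \<and> w \<in> carrier W}
    \<union> {frag_of (v, w \<oplus>\<^bsub>W\<^esub> w') - frag_of (v, w) - frag_of (v, w') | v w w'.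
         v \<in> carrier V \<and> w \<in> carrier W \<and> w' \<in> carrier W}
    \<union> {frag_of (c \<odot>\<^bsub>V\<^esub> v, w) - frag_of (v, c \<odot>\<^bsub>W\<^esub> w) | c v w.
         c \<in> carrier K \<and> v \<in> carrier V \<and> w \<in> carrier W}"

definition tensor_null ::
    "('k, 'm) ring_scheme \<Rightarrow> ('k, 'v, 'n) module_scheme \<Rightarrow> ('k, 'w, 'p) module_scheme
     \<Rightarrow> ('v \<times> 'w \<Rightarrow>\<^sub>0 int) set"
  where "tensor_null K V W =
    generate (free_Abelian_group (carrier V \<times> carrier W)) (tensor_relations K V W)"

definition tensor_class ::
    "('k, 'm) ring_scheme \<Rightarrow> ('k, 'v, 'n) module_scheme \<Rightarrow> ('k, 'w, 'p) module_scheme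
     \<Rightarrow> ('v \<times> 'w \<Rightarrow>\<^sub>0 int) \<Rightarrow> ('v \<times> 'w \<Rightarrow>\<^sub>0 int) set"
  where "tensor_class K V W x =
    tensor_null K V W #>\<^bsub>free_Abelian_group (carrier V \<times> carrier W)\<^esub> x"

definition pure_tensor ::
    "('k, 'm) ring_scheme \<Rightarrow> ('k, 'v, 'n) module_scheme \<Rightarrow> ('k, 'w, 'p) module_scheme
     \<Rightarrow> 'v \<Rightarrow> 'w \<Rightarrow> ('v \<times> 'w \<Rightarrow>\<^sub>0 int) set"
  where "pure_tensor K V W v w = tensor_class K V W (frag_of (v, w))"

text \<open>For linear endomorphisms \<open>f\<close> of \<open>V\<close> and \<open>g\<close> of \<open>W\<close>, all representatives of a class yield
  the same class, so the union is that class: this is the induced map \<open>f \<otimes> g\<close>.\<close>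

definition tensor_map ::
    "('k, 'm) ring_scheme \<Rightarrow> ('k, 'v, 'n) module_scheme \<Rightarrow> ('k, 'w, 'p) module_scheme
     \<Rightarrow> ('v \<Rightarrow> 'v) \<Rightarrow> ('w \<Rightarrow> 'w)
     \<Rightarrow> ('v \<times> 'w \<Rightarrow>\<^sub>0 int) set \<Rightarrow> ('v \<times> 'w \<Rightarrow>\<^sub>0 int) set"
  where "tensor_map K V W f g X =
    (\<Union>x\<in>X. tensor_class K V W (frag_extend (\<lambda>(v, w). frag_of (f v, g w)) x))"

text \<open>The operations \<open>mult\<close> and \<open>one\<close>, which module records inherit from rings, play no role
  here.\<close>

definition tensor_product ::
    "('k, 'm) ring_scheme \<Rightarrow> ('k, 'v, 'n) module_scheme \<Rightarrow> ('k, 'w, 'p) module_scheme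
     \<Rightarrow> ('k, ('v \<times> 'w \<Rightarrow>\<^sub>0 int) set) module"
  where "tensor_product K V W =
    (let Q = free_Abelian_group (carrier V \<times> carrier W) Mod tensor_null K V W in
     \<lparr>carrier = carrier Q, monoid.mult = undefined, one = undefined,
      ring.zero = \<one>\<^bsub>Q\<^esub>, add = monoid.mult Q,
      smult = (\<lambda>c. tensor_map K V W (\<lambda>v. c \<odot>\<^bsub>V\<^esub> v) (\<lambda>w. w))\<rparr>)"

definition representation_loop ::
    "('k, 'm) ring_scheme \<Rightarrow> ('g, 'q) monoid_scheme
     \<Rightarrow> ('k, 'v, 'n) module_scheme \<Rightarrow> ('g \<Rightarrow> 'v \<Rightarrow> 'v)
     \<Rightarrow> ('k, 'w, 'p) module_scheme \<Rightarrow> ('g \<Rightarrow> 'w \<Rightarrow> 'w)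
     \<Rightarrow> (('v \<times> 'w \<Rightarrow>\<^sub>0 int) set \<times> 'g) monoid"
  where "representation_loop K G V \<rho> W \<sigma> =
    \<lparr>carrier = carrier (tensor_product K V W) \<times> carrier G,
     monoid.mult = (\<lambda>(x, a) (y, b).
       (tensor_map K V W
          (\<rho> (inv\<^bsub>G\<^esub> b \<otimes>\<^bsub>G\<^esub> inv\<^bsub>G\<^esub> a \<otimes>\<^bsub>G\<^esub> b \<otimes>\<^bsub>G\<^esub> a)) (\<lambda>w. w) x
        \<oplus>\<^bsub>tensor_product K V W\<^esub>
        tensor_map K V W
          (\<rho> (inv\<^bsub>G\<^esub> b \<otimes>\<^bsub>G\<^esub> a [^]\<^bsub>G\<^esub> (-2::int) \<otimes>\<^bsub>G\<^esub> b)) (\<sigma> a) y,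
        a \<otimes>\<^bsub>G\<^esub> b)),
     one = (\<zero>\<^bsub>tensor_product K V W\<^esub>, \<one>\<^bsub>G\<^esub>)\<rparr>"

end

theory Submission
  imports Defs
begin

text \<open>Through the maps \<open>\<rho> g \<otimes> \<sigma> h\<close> the group \<open>G \<times> G\<close> acts on the
  abelian group \<open>V \<otimes> W\<close> by automorphisms. Writing \<open>M g h\<close> for the action of \<open>(g, h)\<close>, the product is
  \<open>(x, a) (y, b) = (M (b\<inverse> a\<inverse> b a) 1 x + M (b\<inverse> a\<^sup>-\<^sup>2 b) a y, a b)\<close>,
  and everything follows from this form alone.

  For the loop axioms, fix one factor. The \<open>G\<close>-components determine each other by a division
  in \<open>G\<close>; once they are known, the unknown vector is hit by one invertible operator \<open>M g h\<close>
  and shifted by a known vector, so it can be solved for uniquely. The unit laws hold because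
  the word acting on the other vector becomes trivial when one factor is \<open>(0, 1)\<close>.

  For the Moufang identities with the element \<open>(0, a)\<close>, both sides are again of the form
  \<open>(M g h x + M g' h' y, d)\<close>, because each \<open>M g h\<close> is additive and composition multiplies the
  group elements in both arguments. The identity is thus a comparison of words in the free group on
  \<open>a\<close>, \<open>b\<close>, \<open>c\<close>, where \<open>b\<close> and \<open>c\<close> are the group components of the other two factors. In
  \<open>a (x (a y)) = ((a x) a) y\<close> both sides have the \<open>V\<close>-words \<open>c\<inverse> a\<inverse> b\<inverse> a\<inverse> c b\<close> and
  \<open>c\<inverse> a\<inverse> b\<inverse> a\<inverse> a\<inverse> b\<inverse> a\<inverse> c\<close> and the \<open>W\<close>-words \<open>a\<close> and \<open>a b a\<close>; the second identity is
  similar (\<open>zero_section_moufang\<close>). For \<open>x = y = 0\<close> the product is just that of \<open>G\<close>.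

  What remains is the functoriality of the tensor product (\<open>tensor_map_class\<close> and its
  consequences), which turns the two representations into the action \<open>M\<close>
  (\<open>representation_biaction_loop\<close>).\<close>

section \<open>The loop of a pair of commuting actions on an abelian group\<close>

text \<open>An action of \<open>G \<times> G\<close> on the abelian group \<open>T\<close> by automorphisms, in curried form.\<close>

locale biaction = T?: abelian_group T + G?: group G for T (structure) and G (structure) +
  fixes M :: "'b \<Rightarrow> 'b \<Rightarrow> 'a \<Rightarrow> 'a"
  assumes M_closed [simp]:
      "\<lbrakk>g \<in> carrier G; h \<in> carrier G; x \<in> carrier T\<rbrakk> \<Longrightarrow> M g h x \<in> carrier T"
    and M_add:
      "\<lbrakk>g \<in> carrier G; h \<in> carrier G; x \<in> carrier T; y \<in> carrier T\<rbrakk>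
       \<Longrightarrow> M g h (x \<oplus>\<^bsub>T\<^esub> y) = M g h x \<oplus>\<^bsub>T\<^esub> M g h y"
    and M_one [simp]: "x \<in> carrier T \<Longrightarrow> M \<one>\<^bsub>G\<^esub> \<one>\<^bsub>G\<^esub> x = x"
    and M_mult:
      "\<lbrakk>g \<in> carrier G; g' \<in> carrier G; h \<in> carrier G; h' \<in> carrier G; x \<in> carrier T\<rbrakk>
       \<Longrightarrow> M g h (M g' h' x) = M (g \<otimes>\<^bsub>G\<^esub> g') (h \<otimes>\<^bsub>G\<^esub> h') x"
begin

lemma M_zero [simp]:
  assumes "g \<in> carrier G" "h \<in> carrier G"
  shows "M g h \<zero>\<^bsub>T\<^esub> = \<zero>\<^bsub>T\<^esub>"
proof -
  have "M g h \<zero>\<^bsub>T\<^esub> \<oplus>\<^bsub>T\<^esub> M g h \<zero>\<^bsub>T\<^esub> = M g h \<zero>\<^bsub>T\<^esub> \<oplus>\<^bsub>T\<^esub> \<zero>\<^bsub>T\<^esub>"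
    using assms M_add[of g h "\<zero>\<^bsub>T\<^esub>" "\<zero>\<^bsub>T\<^esub>"] by simp
  with assms show ?thesis by (simp del: T.r_zero add: T.add.l_cancel_one)
qed

lemma M_inv_left [simp]:
  "\<lbrakk>g \<in> carrier G; h \<in> carrier G; x \<in> carrier T\<rbrakk>
   \<Longrightarrow> M (inv\<^bsub>G\<^esub> g) (inv\<^bsub>G\<^esub> h) (M g h x) = x"
  by (simp add: M_mult)

lemma M_inv_right [simp]:
  "\<lbrakk>g \<in> carrier G; h \<in> carrier G; x \<in> carrier T\<rbrakk>
   \<Longrightarrow> M g h (M (inv\<^bsub>G\<^esub> g) (inv\<^bsub>G\<^esub> h) x) = x"
  by (simp add: M_mult)

lemma M_inj:
  "\<lbrakk>g \<in> carrier G; h \<in> carrier G; x \<in> carrier T; y \<in> carrier T; M g h x = M g h y\<rbrakk> \<Longrightarrow> x = y"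
  by (metis M_inv_left)

end

text \<open>Together with associativity to the right and the rule for inverses of products, these two
  rewrite rules bring every group word to its freely reduced form.\<close>

lemma (in group) inv_mult_cancel [simp]:
  "\<lbrakk>x \<in> carrier G; y \<in> carrier G\<rbrakk> \<Longrightarrow> inv x \<otimes> (x \<otimes> y) = y"
  "\<lbrakk>x \<in> carrier G; y \<in> carrier G\<rbrakk> \<Longrightarrow> x \<otimes> (inv x \<otimes> y) = y"
  by (simp_all flip: m_assoc)

lemma (in group) int_pow_minus_two:
  "a \<in> carrier G \<Longrightarrow> a [^] (-2::int) = inv a \<otimes> inv a"
  by (simp add: int_pow_def2 numeral_2_eq_2 inv_mult_group)

text \<open>The product is only prescribed on the carrier: a concrete model may use another
  expression for the operators that agrees with \<open>M\<close> on \<open>T\<close>.\<close>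

locale biaction_loop = biaction T G M for T (structure) and G (structure) and M +
  fixes E (structure)
  assumes carrier_E: "carrier E = carrier T \<times> carrier G"
    and one_E: "\<one>\<^bsub>E\<^esub> = (\<zero>\<^bsub>T\<^esub>, \<one>\<^bsub>G\<^esub>)"
    and mult_E:
      "\<lbrakk>x \<in> carrier T; a \<in> carrier G; y \<in> carrier T; b \<in> carrier G\<rbrakk>
       \<Longrightarrow> (x, a) \<otimes>\<^bsub>E\<^esub> (y, b) =
         (M (inv\<^bsub>G\<^esub> b \<otimes>\<^bsub>G\<^esub> inv\<^bsub>G\<^esub> a \<otimes>\<^bsub>G\<^esub> b \<otimes>\<^bsub>G\<^esub> a) \<one>\<^bsub>G\<^esub> x
          \<oplus>\<^bsub>T\<^esub> M (inv\<^bsub>G\<^esub> b \<otimes>\<^bsub>G\<^esub> a [^]\<^bsub>G\<^esub> (-2::int) \<otimes>\<^bsub>G\<^esub> b) a y,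
          a \<otimes>\<^bsub>G\<^esub> b)"
begin

text \<open>The operator applied to the second vector is \<open>M g a\<close> with \<open>g = b\<inverse> a\<^sup>-\<^sup>2 b\<close>, which is
  invertible, and \<open>b\<close> is recovered as \<open>a\<inverse> c\<close> from the group component \<open>c\<close> of the product.\<close>

lemma left_mult_bij:
  assumes "p \<in> carrier E"
  shows "bij_betw (\<lambda>q. p \<otimes>\<^bsub>E\<^esub> q) (carrier E) (carrier E)"
proof -
  obtain x a where p: "p = (x, a)" and x: "x \<in> carrier T" and a: "a \<in> carrier G"
    using assms by (auto simp: carrier_E)
  show ?thesis
  proof (rule bij_betw_imageI)
    show "inj_on (\<lambda>q. p \<otimes>\<^bsub>E\<^esub> q) (carrier E)"
    proof (rule inj_onI)
      fix q q' assume q: "q \<in> carrier E" "q' \<in> carrier E" and eq: "p \<otimes>\<^bsub>E\<^esub> q = p \<otimes>\<^bsub>E\<^esub> q'"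
      obtain y b y' b' where yb: "q = (y, b)" "q' = (y', b')"
          "y \<in> carrier T" "b \<in> carrier G" "y' \<in> carrier T" "b' \<in> carrier G"
        using q by (auto simp: carrier_E)
      have b: "b' = b" using eq yb x a by (simp add: p mult_E)
      have "M (inv\<^bsub>G\<^esub> b \<otimes>\<^bsub>G\<^esub> a [^]\<^bsub>G\<^esub> (-2::int) \<otimes>\<^bsub>G\<^esub> b) a y
          = M (inv\<^bsub>G\<^esub> b \<otimes>\<^bsub>G\<^esub> a [^]\<^bsub>G\<^esub> (-2::int) \<otimes>\<^bsub>G\<^esub> b) a y'"
        using eq yb x a by (simp add: p mult_E b)
      then have "y = y'" by (rule M_inj[rotated 4]) (use yb a in auto)
      with b yb show "q = q'" by simp
    qed
    show "(\<lambda>q. p \<otimes>\<^bsub>E\<^esub> q) ` carrier E = carrier E"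
    proof
      show "(\<lambda>q. p \<otimes>\<^bsub>E\<^esub> q) ` carrier E \<subseteq> carrier E"
        using x a by (auto simp: carrier_E p mult_E)
      show "carrier E \<subseteq> (\<lambda>q. p \<otimes>\<^bsub>E\<^esub> q) ` carrier E"
      proof
        fix r assume "r \<in> carrier E"
        then obtain z c where r: "r = (z, c)" and z: "z \<in> carrier T" and c: "c \<in> carrier G"
          by (auto simp: carrier_E)
        define b where "b = inv\<^bsub>G\<^esub> a \<otimes>\<^bsub>G\<^esub> c"
        define g where "g = inv\<^bsub>G\<^esub> b \<otimes>\<^bsub>G\<^esub> a [^]\<^bsub>G\<^esub> (-2::int) \<otimes>\<^bsub>G\<^esub> b"
        define u where "u = M (inv\<^bsub>G\<^esub> b \<otimes>\<^bsub>G\<^esub> inv\<^bsub>G\<^esub> a \<otimes>\<^bsub>G\<^esub> b \<otimes>\<^bsub>G\<^esub> a) \<one>\<^bsub>G\<^esub> x"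
        define y where "y = M (inv\<^bsub>G\<^esub> g) (inv\<^bsub>G\<^esub> a) (\<ominus>\<^bsub>T\<^esub> u \<oplus>\<^bsub>T\<^esub> z)"
        have b: "b \<in> carrier G" using a c by (simp add: b_def)
        have g: "g \<in> carrier G" using a b by (simp add: g_def)
        have u: "u \<in> carrier T" using a b x by (simp add: u_def)
        have y: "y \<in> carrier T" using a g u z by (simp add: y_def)
        have "p \<otimes>\<^bsub>E\<^esub> (y, b) = (u \<oplus>\<^bsub>T\<^esub> M g a y, a \<otimes>\<^bsub>G\<^esub> b)"
          using x a y b by (simp add: p mult_E u_def g_def)
        also have "\<dots> = r"
          using a c g u z by (simp add: y_def b_def r T.r_neg1)
        finally show "r \<in> (\<lambda>q. p \<otimes>\<^bsub>E\<^esub> q) ` carrier E"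
          using y b by (auto simp: carrier_E)
      qed
    qed
  qed
qed

text \<open>The same argument, now with the invertible operator \<open>M g 1\<close>, \<open>g = b\<inverse> a\<inverse> b a\<close>, on the
  first vector and \<open>a = c b\<inverse>\<close>.\<close>

lemma right_mult_bij:
  assumes "q \<in> carrier E"
  shows "bij_betw (\<lambda>p. p \<otimes>\<^bsub>E\<^esub> q) (carrier E) (carrier E)"
proof -
  obtain y b where q: "q = (y, b)" and y: "y \<in> carrier T" and b: "b \<in> carrier G"
    using assms by (auto simp: carrier_E)
  show ?thesis
  proof (rule bij_betw_imageI)
    show "inj_on (\<lambda>p. p \<otimes>\<^bsub>E\<^esub> q) (carrier E)"
    proof (rule inj_onI)
      fix p p' assume p: "p \<in> carrier E" "p' \<in> carrier E" and eq: "p \<otimes>\<^bsub>E\<^esub> q = p' \<otimes>\<^bsub>E\<^esub> q"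
      obtain x a x' a' where xa: "p = (x, a)" "p' = (x', a')"
          "x \<in> carrier T" "a \<in> carrier G" "x' \<in> carrier T" "a' \<in> carrier G"
        using p by (auto simp: carrier_E)
      have a: "a' = a" using eq xa y b by (simp add: q mult_E)
      have "M (inv\<^bsub>G\<^esub> b \<otimes>\<^bsub>G\<^esub> inv\<^bsub>G\<^esub> a \<otimes>\<^bsub>G\<^esub> b \<otimes>\<^bsub>G\<^esub> a) \<one>\<^bsub>G\<^esub> x
          = M (inv\<^bsub>G\<^esub> b \<otimes>\<^bsub>G\<^esub> inv\<^bsub>G\<^esub> a \<otimes>\<^bsub>G\<^esub> b \<otimes>\<^bsub>G\<^esub> a) \<one>\<^bsub>G\<^esub> x'"
        using eq xa y b by (simp add: q mult_E a)
      then have "x = x'" by (rule M_inj[rotated 4]) (use xa b in auto)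
      with a xa show "p = p'" by simp
    qed
    show "(\<lambda>p. p \<otimes>\<^bsub>E\<^esub> q) ` carrier E = carrier E"
    proof
      show "(\<lambda>p. p \<otimes>\<^bsub>E\<^esub> q) ` carrier E \<subseteq> carrier E"
        using y b by (auto simp: carrier_E q mult_E)
      show "carrier E \<subseteq> (\<lambda>p. p \<otimes>\<^bsub>E\<^esub> q) ` carrier E"
      proof
        fix r assume "r \<in> carrier E"
        then obtain z c where r: "r = (z, c)" and z: "z \<in> carrier T" and c: "c \<in> carrier G"
          by (auto simp: carrier_E)
        define a where "a = c \<otimes>\<^bsub>G\<^esub> inv\<^bsub>G\<^esub> b"
        define g where "g = inv\<^bsub>G\<^esub> b \<otimes>\<^bsub>G\<^esub> inv\<^bsub>G\<^esub> a \<otimes>\<^bsub>G\<^esub> b \<otimes>\<^bsub>G\<^esub> a"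
        define u where "u = M (inv\<^bsub>G\<^esub> b \<otimes>\<^bsub>G\<^esub> a [^]\<^bsub>G\<^esub> (-2::int) \<otimes>\<^bsub>G\<^esub> b) a y"
        define x where "x = M (inv\<^bsub>G\<^esub> g) (inv\<^bsub>G\<^esub> \<one>\<^bsub>G\<^esub>) (z \<oplus>\<^bsub>T\<^esub> \<ominus>\<^bsub>T\<^esub> u)"
        have a: "a \<in> carrier G" using b c by (simp add: a_def)
        have g: "g \<in> carrier G" using a b by (simp add: g_def)
        have u: "u \<in> carrier T" using a b y by (simp add: u_def)
        have x: "x \<in> carrier T" using g u z by (simp add: x_def)
        have "(x, a) \<otimes>\<^bsub>E\<^esub> q = (M g \<one>\<^bsub>G\<^esub> x \<oplus>\<^bsub>T\<^esub> u, a \<otimes>\<^bsub>G\<^esub> b)"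
          using x a y b by (simp add: q mult_E u_def g_def)
        also have "M g \<one>\<^bsub>G\<^esub> x = z \<oplus>\<^bsub>T\<^esub> \<ominus>\<^bsub>T\<^esub> u"
          unfolding x_def using g u z by (intro M_inv_right) auto
        also have "(z \<oplus>\<^bsub>T\<^esub> \<ominus>\<^bsub>T\<^esub> u \<oplus>\<^bsub>T\<^esub> u, a \<otimes>\<^bsub>G\<^esub> b) = r"
          using b c u z by (simp add: a_def r T.a_assoc G.m_assoc T.l_neg)
        finally show "r \<in> (\<lambda>p. p \<otimes>\<^bsub>E\<^esub> q) ` carrier E"
          using x a by (auto simp: carrier_E)
      qed
    qed
  qed
qed

lemma is_loop: "loop E"
proof
  fix p q assume "p \<in> carrier E" "q \<in> carrier E"
  then show "p \<otimes>\<^bsub>E\<^esub> q \<in> carrier E" by (auto simp: carrier_E mult_E)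
next
  show "\<one>\<^bsub>E\<^esub> \<in> carrier E" by (simp add: carrier_E one_E)
next
  fix p assume "p \<in> carrier E"
  then show "\<one>\<^bsub>E\<^esub> \<otimes>\<^bsub>E\<^esub> p = p" "p \<otimes>\<^bsub>E\<^esub> \<one>\<^bsub>E\<^esub> = p"
    by (auto simp: carrier_E one_E mult_E)
qed (rule left_mult_bij right_mult_bij; assumption)+

text \<open>Expanding both sides with additivity and \<open>M_mult\<close> leaves, for each of the two vectors
  involved, a single operator \<open>M g h\<close> whose words freely reduce to the same normal form on
  either side.\<close>

lemma zero_section_moufang: "{\<zero>\<^bsub>T\<^esub>} \<times> carrier G \<subseteq> moufang_elements E"
proof -
  have "p \<otimes>\<^bsub>E\<^esub> (q \<otimes>\<^bsub>E\<^esub> (p \<otimes>\<^bsub>E\<^esub> r)) = ((p \<otimes>\<^bsub>E\<^esub> q) \<otimes>\<^bsub>E\<^esub> p) \<otimes>\<^bsub>E\<^esub> r \<and>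
      ((q \<otimes>\<^bsub>E\<^esub> p) \<otimes>\<^bsub>E\<^esub> r) \<otimes>\<^bsub>E\<^esub> p = q \<otimes>\<^bsub>E\<^esub> (p \<otimes>\<^bsub>E\<^esub> (r \<otimes>\<^bsub>E\<^esub> p))"
    if "a \<in> carrier G" "p = (\<zero>\<^bsub>T\<^esub>, a)" "q \<in> carrier E" "r \<in> carrier E" for p q r a
    using that
    by (auto simp: carrier_E mult_E M_add M_mult G.int_pow_minus_two G.m_assoc G.inv_mult_group)
  then show ?thesis by (auto simp: moufang_elements_def carrier_E)
qed

lemma zero_section_iso:
  "(\<lambda>a. (\<zero>\<^bsub>T\<^esub>, a)) \<in> iso G (E\<lparr>carrier := {\<zero>\<^bsub>T\<^esub>} \<times> carrier G\<rparr>)"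
  by (auto simp: iso_def hom_def mult_E bij_betw_def inj_on_def)

end

section \<open>Functoriality of the tensor product\<close>

locale module_pair = V: module K V + W: module K W for K and V and W
begin

abbreviation "F \<equiv> free_Abelian_group (carrier V \<times> carrier W)"
abbreviation "N \<equiv> tensor_null K V W"
abbreviation "cl \<equiv> tensor_class K V W"
abbreviation "T \<equiv> tensor_product K V W"

lemma tensor_relations_subset: "tensor_relations K V W \<subseteq> carrier F"
proof -
  have diff: "x - y \<in> carrier F" if "x \<in> carrier F" "y \<in> carrier F" for x y
    using that keys_diff[of x y] by (auto simp del: keys_diff)
  show ?thesis
    unfolding tensor_relations_def
    by (auto simp del: carrier_free_Abelian_group_iff intro!: diff)
qed

sublocale F: comm_group F
  by (rule abelian_free_Abelian_group)

lemma subgroup_null: "subgroup N F"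
  unfolding tensor_null_def by (rule F.generate_is_subgroup[OF tensor_relations_subset])

text \<open>Elements of the tensor product are handled through representatives, and this criterion
  reduces their equality to membership in the null subgroup.\<close>

lemma class_eq_iff:
  assumes "x \<in> carrier F" "y \<in> carrier F"
  shows "cl x = cl y \<longleftrightarrow> x - y \<in> N"
proof -
  have "cl x = cl y \<longleftrightarrow> x \<in> cl y"
    using F.repr_independence[OF _ assms(2) subgroup_null] F.rcos_self[OF assms(1) subgroup_null]
    unfolding tensor_class_def by blast
  also have "\<dots> \<longleftrightarrow> x - y \<in> N"
    unfolding tensor_class_def r_coset_def by (auto simp: algebra_simps) (metis diff_add_cancel)
  finally show ?thesis .
qed

lemma carrier_T: "carrier T = cl ` carrier F"
  by (simp add: tensor_product_def Let_def carrier_FactGroup tensor_class_def)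

lemma zero_T: "\<zero>\<^bsub>T\<^esub> = cl 0"
  using F.coset_mult_one[OF subgroup.subset[OF subgroup_null]]
  by (simp add: tensor_product_def Let_def tensor_class_def)

lemma add_T:
  assumes "x \<in> carrier F" "y \<in> carrier F"
  shows "cl x \<oplus>\<^bsub>T\<^esub> cl y = cl (x + y)"
  using normal.rcos_sum[OF F.subgroup_imp_normal[OF subgroup_null] assms]
  by (simp add: tensor_product_def Let_def tensor_class_def)

lemma abelian_group_T: "abelian_group T"
proof -
  interpret Q: comm_group "F Mod N"
    by (rule F.abelian_FactGroup[OF subgroup_null])
  have eqs: "carrier T = carrier (F Mod N)" "add T = monoid.mult (F Mod N)" "\<zero>\<^bsub>T\<^esub> = \<one>\<^bsub>F Mod N\<^esub>"
    by (simp_all add: tensor_product_def Let_def)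
  show ?thesis
    by (rule abelian_groupI; unfold eqs)
       (rule Q.m_closed Q.one_closed Q.m_assoc Q.m_comm Q.l_one Q.l_inv_ex; assumption)+
qed

lemma pure_tensor_closed:
  "\<lbrakk>v \<in> carrier V; w \<in> carrier W\<rbrakk> \<Longrightarrow> pure_tensor K V W v w \<in> carrier T"
  by (simp add: pure_tensor_def carrier_T)

text \<open>The instance \<open>(0 + 0, 0) - (0, 0) - (0, 0)\<close> of additivity in the first argument reduces to
  \<open>- (0, 0)\<close>, so the pair \<open>(0, 0)\<close> is itself null.\<close>

lemma pure_tensor_zero: "pure_tensor K V W \<zero>\<^bsub>V\<^esub> \<zero>\<^bsub>W\<^esub> = \<zero>\<^bsub>T\<^esub>"
proof -
  let ?z = "frag_of (\<zero>\<^bsub>V\<^esub>, \<zero>\<^bsub>W\<^esub>)"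
  have "frag_of (\<zero>\<^bsub>V\<^esub> \<oplus>\<^bsub>V\<^esub> \<zero>\<^bsub>V\<^esub>, \<zero>\<^bsub>W\<^esub>) - ?z - ?z \<in> tensor_relations K V W"
    unfolding tensor_relations_def by blast
  then have "0 - ?z \<in> N"
    unfolding tensor_null_def by (auto intro: generate.incl)
  then show ?thesis
    by (simp add: pure_tensor_def zero_T class_eq_iff[of 0 ?z, THEN iffD2, symmetric])
qed

end

definition linear_endos :: "('k, 'm) ring_scheme \<Rightarrow> ('k, 'v, 'n) module_scheme \<Rightarrow> ('v \<Rightarrow> 'v) set"
  where "linear_endos K V = {f \<in> carrier V \<rightarrow> carrier V.
     (\<forall>u \<in> carrier V. \<forall>v \<in> carrier V. f (u \<oplus>\<^bsub>V\<^esub> v) = f u \<oplus>\<^bsub>V\<^esub> f v) \<and>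
     (\<forall>c \<in> carrier K. \<forall>v \<in> carrier V. f (c \<odot>\<^bsub>V\<^esub> v) = c \<odot>\<^bsub>V\<^esub> f v)}"

lemma id_linear: "(\<lambda>v. v) \<in> linear_endos K V"
  by (simp add: linear_endos_def)

lemma comp_linear:
  "\<lbrakk>f \<in> linear_endos K V; g \<in> linear_endos K V\<rbrakk> \<Longrightarrow> f \<circ> g \<in> linear_endos K V"
  by (auto simp: linear_endos_def Pi_iff)

text \<open>The lift of \<open>f \<otimes> g\<close> to representatives, that is, to formal sums of pairs.\<close>

abbreviation frag_map :: "('v \<Rightarrow> 'v) \<Rightarrow> ('w \<Rightarrow> 'w) \<Rightarrow> ('v \<times> 'w \<Rightarrow>\<^sub>0 int) \<Rightarrow> ('v \<times> 'w \<Rightarrow>\<^sub>0 int)"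
  where "frag_map f g \<equiv> frag_extend (\<lambda>(v, w). frag_of (f v, g w))"

context module_pair
begin

lemma frag_map_closed:
  assumes "f \<in> carrier V \<rightarrow> carrier V" "g \<in> carrier W \<rightarrow> carrier W" "x \<in> carrier F"
  shows "frag_map f g x \<in> carrier F"
  using keys_frag_extend[of "\<lambda>(v, w). frag_of (f v, g w)" x] assms by fastforce

text \<open>Linearity of \<open>f\<close> and \<open>g\<close> sends each defining relation of the tensor product to a defining
  relation of the same kind, hence the subgroup they generate into itself.\<close>

lemma frag_map_null:
  assumes f: "f \<in> linear_endos K V" and g: "g \<in> linear_endos K W" and x: "x \<in> N"
  shows "frag_map f g x \<in> N"
proof -
  have rel: "frag_map f g r \<in> N" if "r \<in> tensor_relations K V W" for r
  proof -
    have "frag_map f g r \<in> tensor_relations K V W"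
      using that f g
      unfolding tensor_relations_def linear_endos_def
      by (elim UnE CollectE exE conjE; simp add: frag_extend_diff)
         (blast dest: funcset_mem)+
    then show ?thesis unfolding tensor_null_def by (rule generate.incl)
  qed
  have "x \<in> generate F (tensor_relations K V W)" using x by (simp add: tensor_null_def)
  then show ?thesis
  proof induction
    case one
    then show ?case using subgroup.one_closed[OF subgroup_null] by simp
  next
    case (incl r)
    then show ?case by (rule rel)
  next
    case (inv r)
    then have "r \<in> carrier F" using tensor_relations_subset by blast
    moreover have "- frag_map f g r \<in> N"
      using subgroup.m_inv_closed[OF subgroup_null rel[OF inv]]
        subgroup.mem_carrier[OF subgroup_null rel[OF inv]] by simp
    ultimately show ?case by (simp add: frag_extend_minus)
  next
    case (eng x y)
    then show ?case using subgroup.m_closed[OF subgroup_null] by (simp add: frag_extend_add)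
  qed
qed

text \<open>Here \<open>f \<otimes> g\<close> becomes computable on a chosen representative: two representatives differ by
  a null element, which \<open>frag_map_null\<close> keeps null, so all members of the union that defines
  \<open>tensor_map\<close> coincide. Additivity, identity and composition are then inherited from formal sums.\<close>

lemma tensor_map_class:
  assumes f: "f \<in> linear_endos K V" and g: "g \<in> linear_endos K W" and x: "x \<in> carrier F"
  shows "tensor_map K V W f g (cl x) = cl (frag_map f g x)"
proof -
  have fg: "f \<in> carrier V \<rightarrow> carrier V" "g \<in> carrier W \<rightarrow> carrier W"
    using f g by (auto simp: linear_endos_def)
  have "cl (frag_map f g y) = cl (frag_map f g x)" if "y \<in> cl x" for y
  proof -
    have y: "y \<in> carrier F"
      using that x F.r_coset_subset_G[OF subgroup.subset[OF subgroup_null]]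
      unfolding tensor_class_def by blast
    have "y - x \<in> N"
      using that unfolding tensor_class_def r_coset_def by auto
    then have "frag_map f g (y - x) \<in> N" by (rule frag_map_null[OF f g])
    then show ?thesis
      using class_eq_iff[OF frag_map_closed[OF fg y] frag_map_closed[OF fg x]]
      by (simp add: frag_extend_diff)
  qed
  moreover have "x \<in> cl x"
    using F.rcos_self[OF x subgroup_null] by (simp add: tensor_class_def)
  ultimately show ?thesis unfolding tensor_map_def by (intro SUP_eq_const) blast+
qed

lemma tensor_map_closed:
  assumes "f \<in> linear_endos K V" "g \<in> linear_endos K W" "X \<in> carrier T"
  shows "tensor_map K V W f g X \<in> carrier T"
  using assms frag_map_closed[of f g]
  by (auto simp: carrier_T tensor_map_class linear_endos_def simp del: carrier_free_Abelian_group_iff)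

lemma tensor_map_add:
  assumes fg: "f \<in> linear_endos K V" "g \<in> linear_endos K W" and XY: "X \<in> carrier T" "Y \<in> carrier T"
  shows "tensor_map K V W f g (X \<oplus>\<^bsub>T\<^esub> Y)
    = tensor_map K V W f g X \<oplus>\<^bsub>T\<^esub> tensor_map K V W f g Y"
proof -
  obtain x y where xy: "x \<in> carrier F" "y \<in> carrier F" "X = cl x" "Y = cl y"
    using XY by (auto simp: carrier_T simp del: carrier_free_Abelian_group_iff)
  have "x + y \<in> carrier F" using F.m_closed[OF xy(1,2)] by simp
  moreover have "frag_map f g x \<in> carrier F" "frag_map f g y \<in> carrier F"
    using fg xy frag_map_closed unfolding linear_endos_def by blast+
  ultimately show ?thesis
    using fg xy
    by (simp add: add_T tensor_map_class frag_extend_add del: carrier_free_Abelian_group_iff)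
qed

lemma frag_map_cong:
  assumes "x \<in> carrier F"
    and "\<And>v. v \<in> carrier V \<Longrightarrow> f v = f' v" "\<And>w. w \<in> carrier W \<Longrightarrow> g w = g' w"
  shows "frag_map f g x = frag_map f' g' x"
  using assms by (intro frag_extend_eq) auto

text \<open>Needed because representing permutations are \<open>undefined\<close> off the carrier, so that for
  instance \<open>\<sigma> \<one>\<close> and the identity are different functions that induce the same map.\<close>

lemma tensor_map_cong:
  assumes "f \<in> linear_endos K V" "g \<in> linear_endos K W" "f' \<in> linear_endos K V" "g' \<in> linear_endos K W"
    and "X \<in> carrier T"
    and "\<And>v. v \<in> carrier V \<Longrightarrow> f v = f' v" "\<And>w. w \<in> carrier W \<Longrightarrow> g w = g' w"
  shows "tensor_map K V W f g X = tensor_map K V W f' g' X"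
  using assms frag_map_cong[of _ f f' g g']
  by (auto simp: carrier_T tensor_map_class simp del: carrier_free_Abelian_group_iff)

lemma tensor_map_id:
  assumes "X \<in> carrier T"
  shows "tensor_map K V W (\<lambda>v. v) (\<lambda>w. w) X = X"
proof -
  have "(\<lambda>(v, w). frag_of (v, w)) = (frag_of :: 'c \<times> 'e \<Rightarrow> _)"
    by auto
  then have "frag_map (\<lambda>v. v) (\<lambda>w. w) x = x" for x :: "'c \<times> 'e \<Rightarrow>\<^sub>0 int"
    using frag_expansion[of x] by simp
  then show ?thesis
    using assms by (auto simp: carrier_T tensor_map_class linear_endos_def
        simp del: carrier_free_Abelian_group_iff)
qed

lemma tensor_map_comp:
  assumes fg: "f \<in> linear_endos K V" "g \<in> linear_endos K W"
    and fg': "f' \<in> linear_endos K V" "g' \<in> linear_endos K W"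
    and X: "X \<in> carrier T"
  shows "tensor_map K V W f g (tensor_map K V W f' g' X)
    = tensor_map K V W (f \<circ> f') (g \<circ> g') X"
proof -
  obtain x where x: "x \<in> carrier F" "X = cl x"
    using X by (auto simp: carrier_T simp del: carrier_free_Abelian_group_iff)
  have comp: "f \<circ> f' \<in> linear_endos K V" "g \<circ> g' \<in> linear_endos K W"
    using fg fg' by (auto intro: comp_linear)
  have "frag_map f' g' x \<in> carrier F"
    using fg' x frag_map_closed unfolding linear_endos_def by blast
  moreover have "frag_map f g (frag_map f' g' x) = frag_map (f \<circ> f') (g \<circ> g') x"
    using frag_extend_compose[of "\<lambda>(v, w). frag_of (f v, g w)" "\<lambda>(v, w). (f' v, g' w)" x]
    by (simp add: comp_def case_prod_beta')
  ultimately show ?thesis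
    using x fg fg' comp
    by (simp add: tensor_map_class del: carrier_free_Abelian_group_iff)
qed

lemma tensor_map_pure:
  assumes "f \<in> linear_endos K V" "g \<in> linear_endos K W" "v \<in> carrier V" "w \<in> carrier W"
  shows "tensor_map K V W f g (pure_tensor K V W v w) = pure_tensor K V W (f v) (g w)"
  using assms by (simp add: pure_tensor_def tensor_map_class)

lemma tensor_map_finsum_pure:
  assumes fg: "f \<in> linear_endos K V" "g \<in> linear_endos K W"
    and "finite I" "v \<in> I \<rightarrow> carrier V" "w \<in> I \<rightarrow> carrier W"
  shows "tensor_map K V W f g (\<Oplus>\<^bsub>T\<^esub>i\<in>I. pure_tensor K V W (v i) (w i))
    = (\<Oplus>\<^bsub>T\<^esub>i\<in>I. pure_tensor K V W (f (v i)) (g (w i)))"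
  using assms(3-5)
proof (induction I rule: finite_induct)
  interpret T: abelian_group T by (rule abelian_group_T)
  case empty
  have "0 \<in> carrier F" by simp
  from tensor_map_class[OF fg this] show ?case
    by (simp add: zero_T)
next
  interpret T: abelian_group T by (rule abelian_group_T)
  case (insert j I)
  have cl: "f u \<in> carrier V" "g t \<in> carrier W" if "u \<in> carrier V" "t \<in> carrier W" for u t
    using fg that by (auto simp: linear_endos_def)
  have vw: "v i \<in> carrier V" "w i \<in> carrier W" if "i \<in> insert j I" for i
    using insert.prems that by auto
  have pc: "pure_tensor K V W (v i) (w i) \<in> carrier T"
    "pure_tensor K V W (f (v i)) (g (w i)) \<in> carrier T" if "i \<in> insert j I" for i
    using vw[OF that] cl by (auto intro: pure_tensor_closed)
  have "(\<lambda>i. pure_tensor K V W (v i) (w i)) \<in> I \<rightarrow> carrier T"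
    "(\<lambda>i. pure_tensor K V W (f (v i)) (g (w i))) \<in> I \<rightarrow> carrier T"
    using pc by auto
  moreover have "tensor_map K V W f g (\<Oplus>\<^bsub>T\<^esub>i\<in>I. pure_tensor K V W (v i) (w i))
      = (\<Oplus>\<^bsub>T\<^esub>i\<in>I. pure_tensor K V W (f (v i)) (g (w i)))"
    using insert.IH insert.prems by (simp add: Pi_iff)
  ultimately show ?case
    using pc[of j] vw[of j] fg insert.hyps
    by (simp add: tensor_map_add tensor_map_pure)
qed

end

section \<open>The loop of two representations\<close>

lemma (in linear_representation) action_linear:
  "g \<in> carrier G \<Longrightarrow> \<rho> g \<in> linear_endos K V"
  by (auto simp: linear_endos_def action_add action_smult element_image)

lemma (in linear_representation) action_mult:
  "\<lbrakk>g \<in> carrier G; h \<in> carrier G; v \<in> carrier V\<rbrakk>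
   \<Longrightarrow> \<rho> (g \<otimes>\<^bsub>G\<^esub> h) v = \<rho> g (\<rho> h v)"
  by (rule composition_rule)

lemma (in linear_representation) action_one:
  "v \<in> carrier V \<Longrightarrow> \<rho> \<one>\<^bsub>G\<^esub> v = v"
  by (metis id_eq_one restrict_apply')

text \<open>The first summand of the product uses the identity on \<open>W\<close> where the abstract product has
  the operator of the unit of \<open>G\<close>; the two agree on the tensor product.\<close>

lemma representation_biaction_loop:
  fixes K (structure) and G (structure)
  assumes "group G" and "linear_representation K G V \<rho>" and "linear_representation K G W \<sigma>"
  shows "biaction_loop (tensor_product K V W) G (\<lambda>g h. tensor_map K V W (\<rho> g) (\<sigma> h))
    (representation_loop K G V \<rho> W \<sigma>)"
proof -
  interpret G: group G by fact
  interpret \<rho>: linear_representation K G V \<rho> by fact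
  interpret \<sigma>: linear_representation K G W \<sigma> by fact
  interpret module_pair K V W by unfold_locales
  interpret T: abelian_group T by (rule abelian_group_T)
  note linear = \<rho>.action_linear \<sigma>.action_linear
  have unit: "tensor_map K V W (\<rho> g) (\<lambda>w. w) x = tensor_map K V W (\<rho> g) (\<sigma> \<one>\<^bsub>G\<^esub>) x"
    if "g \<in> carrier G" "x \<in> carrier T" for g x
    using that by (intro tensor_map_cong linear id_linear) (simp_all add: \<sigma>.action_one)
  show ?thesis
  proof unfold_locales
    show "tensor_map K V W (\<rho> \<one>\<^bsub>G\<^esub>) (\<sigma> \<one>\<^bsub>G\<^esub>) x = x" if "x \<in> carrier T" for x
    proof -
      have "tensor_map K V W (\<rho> \<one>\<^bsub>G\<^esub>) (\<sigma> \<one>\<^bsub>G\<^esub>) x = tensor_map K V W (\<lambda>v. v) (\<lambda>w. w) x"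
        using that
        by (intro tensor_map_cong linear id_linear) (simp_all add: \<rho>.action_one \<sigma>.action_one)
      with that show ?thesis by (simp add: tensor_map_id)
    qed
  next
    fix g g' h h' x
    assume A: "g \<in> carrier G" "g' \<in> carrier G" "h \<in> carrier G" "h' \<in> carrier G" "x \<in> carrier T"
    have "tensor_map K V W (\<rho> g) (\<sigma> h) (tensor_map K V W (\<rho> g') (\<sigma> h') x)
        = tensor_map K V W (\<rho> g \<circ> \<rho> g') (\<sigma> h \<circ> \<sigma> h') x"
      using A by (intro tensor_map_comp linear)
    also have "\<dots> = tensor_map K V W (\<rho> (g \<otimes>\<^bsub>G\<^esub> g')) (\<sigma> (h \<otimes>\<^bsub>G\<^esub> h')) x"
      using A by (intro tensor_map_cong linear comp_linear)
        (simp_all add: \<rho>.action_mult \<sigma>.action_mult)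
    finally show "tensor_map K V W (\<rho> g) (\<sigma> h) (tensor_map K V W (\<rho> g') (\<sigma> h') x)
      = tensor_map K V W (\<rho> (g \<otimes>\<^bsub>G\<^esub> g')) (\<sigma> (h \<otimes>\<^bsub>G\<^esub> h')) x" .
  qed (simp_all add: tensor_map_closed tensor_map_add linear unit representation_loop_def)
qed

theorem proposition4p5:
  fixes K :: "('k, 'm) ring_scheme"
    and G :: "('g, 'q) monoid_scheme"
    and V :: "('k, 'v, 'n) module_scheme" and \<rho> :: "'g \<Rightarrow> 'v \<Rightarrow> 'v"
    and W :: "('k, 'w, 'p) module_scheme" and \<sigma> :: "'g \<Rightarrow> 'w \<Rightarrow> 'w"
  assumes "char_zero_field K"
    and "group G"
    and "linear_representation K G V \<rho>"
    and "linear_representation K G W \<sigma>"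
  defines "T \<equiv> tensor_product K V W"
    and "E \<equiv> representation_loop K G V \<rho> W \<sigma>"
  shows "(\<forall>(n::nat) (m::nat). \<forall>v \<in> {..<n} \<rightarrow> carrier V. \<forall>w \<in> {..<n} \<rightarrow> carrier W.
      \<forall>v' \<in> {..<m} \<rightarrow> carrier V. \<forall>w' \<in> {..<m} \<rightarrow> carrier W.
      \<forall>a \<in> carrier G. \<forall>b \<in> carrier G.
        ((\<Oplus>\<^bsub>T\<^esub>i\<in>{..<n}. pure_tensor K V W (v i) (w i)), a)
        \<otimes>\<^bsub>E\<^esub> ((\<Oplus>\<^bsub>T\<^esub>j\<in>{..<m}. pure_tensor K V W (v' j) (w' j)), b)
        = ((\<Oplus>\<^bsub>T\<^esub>i\<in>{..<n}. pure_tensor K V W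
              (\<rho> (inv\<^bsub>G\<^esub> b \<otimes>\<^bsub>G\<^esub> inv\<^bsub>G\<^esub> a \<otimes>\<^bsub>G\<^esub> b \<otimes>\<^bsub>G\<^esub> a) (v i)) (w i))
           \<oplus>\<^bsub>T\<^esub> (\<Oplus>\<^bsub>T\<^esub>j\<in>{..<m}. pure_tensor K V W
              (\<rho> (inv\<^bsub>G\<^esub> b \<otimes>\<^bsub>G\<^esub> a [^]\<^bsub>G\<^esub> (-2::int) \<otimes>\<^bsub>G\<^esub> b) (v' j)) (\<sigma> a (w' j))),
           a \<otimes>\<^bsub>G\<^esub> b))
    \<and> loop E
    \<and> (\<lambda>a. (pure_tensor K V W \<zero>\<^bsub>V\<^esub> \<zero>\<^bsub>W\<^esub>, a))
         \<in> iso G (E\<lparr>carrier := {pure_tensor K V W \<zero>\<^bsub>V\<^esub> \<zero>\<^bsub>W\<^esub>} \<times> carrier G\<rparr>)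
    \<and> {pure_tensor K V W \<zero>\<^bsub>V\<^esub> \<zero>\<^bsub>W\<^esub>} \<times> carrier G \<subseteq> moufang_elements E"
proof -
  interpret G: group G by fact
  interpret \<rho>: linear_representation K G V \<rho> by fact
  interpret \<sigma>: linear_representation K G W \<sigma> by fact
  interpret TP: module_pair K V W by unfold_locales
  interpret L: biaction_loop T G "\<lambda>g h. tensor_map K V W (\<rho> g) (\<sigma> h)" E
    unfolding T_def E_def
    using representation_biaction_loop[OF \<open>group G\<close> \<rho>.linear_representation_axioms
        \<sigma>.linear_representation_axioms] .
  note zero = TP.pure_tensor_zero[folded T_def]
  have "((\<Oplus>\<^bsub>T\<^esub>i\<in>{..<n}. pure_tensor K V W (v i) (w i)), a)
        \<otimes>\<^bsub>E\<^esub> ((\<Oplus>\<^bsub>T\<^esub>j\<in>{..<m}. pure_tensor K V W (v' j) (w' j)), b)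
        = ((\<Oplus>\<^bsub>T\<^esub>i\<in>{..<n}. pure_tensor K V W
              (\<rho> (inv\<^bsub>G\<^esub> b \<otimes>\<^bsub>G\<^esub> inv\<^bsub>G\<^esub> a \<otimes>\<^bsub>G\<^esub> b \<otimes>\<^bsub>G\<^esub> a) (v i)) (w i))
           \<oplus>\<^bsub>T\<^esub> (\<Oplus>\<^bsub>T\<^esub>j\<in>{..<m}. pure_tensor K V W
              (\<rho> (inv\<^bsub>G\<^esub> b \<otimes>\<^bsub>G\<^esub> a [^]\<^bsub>G\<^esub> (-2::int) \<otimes>\<^bsub>G\<^esub> b) (v' j)) (\<sigma> a (w' j))),
           a \<otimes>\<^bsub>G\<^esub> b)"
    if "v \<in> {..<n} \<rightarrow> carrier V" "w \<in> {..<n} \<rightarrow> carrier W"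
      "v' \<in> {..<m} \<rightarrow> carrier V" "w' \<in> {..<m} \<rightarrow> carrier W" "a \<in> carrier G" "b \<in> carrier G"
    for n m :: nat and v w v' w' a b
    using that TP.tensor_map_finsum_pure[OF \<rho>.action_linear id_linear finite_lessThan that(1,2)]
      TP.tensor_map_finsum_pure[OF \<rho>.action_linear \<sigma>.action_linear finite_lessThan that(3,4)]
    by (simp add: E_def T_def representation_loop_def)
  then show ?thesis
    using L.is_loop L.zero_section_iso L.zero_section_moufang by (simp add: zero)
qed

end
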